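(* Let $\Gamma$ be a finitely generated, infinite group which does not have the Haagerup property (i.e. $\Gamma$ has property $(T_w)$) and let $\mathcal G$ be the Cayley graph of $\Gamma$ with respect to a finite symmetric generating set. Then $\alpha_w^*(\mathcal G)\le\kappa_w(\mathcal G)$.
   Context: Right Cayley graph: vertex set $\Gamma$, edge set $E=\{[g,gs]: g\in\Gamma, s\in S\}$ with $S$ a finite symmetric generating set; $o$ is the identity, $d$ the graph distance, $\deg(o)$ the degree of $o$. $\Gamma$ acts by left multiplication. A $\Gamma$-invariant bond percolation is a probability measure $\mathbb P$ (expectation $\mathbb E$) on subsets $\omega\subset E$ invariant under $\Gamma$; clusters are connected components of $(\Gamma,\omega)$; $\deg_\omega(o)$ is the degree of $o$ in $\omega$; $\tau(g,h)=\mathbb P[g\leftrightarrow h]$ is the probability that $g,h$ are in the same cluster. $\tau(o,\cdot)$ vanishes at infinity if $\lim_{r\to\infty}\sup_{d(g,h)>r}\tau(g,h)=0$. $\Gamma$ has the Haagerup property if there is a sequence of normalized positive definite functions on $\Gamma$ which vanish at infinity and converge pointwise to $1$ (equivalently, $\Gamma$ admits a metrically proper affine isometric action on a Hilbert space). Here $\varphi:\Gamma\to\mathbb C$ is positive definite if $\sum_{i,j}\overline{a_i}a_j\varphi(g_i^{-1}g_j)\ge0$ for all finite families $g_i\in\Gamma$, $a_i\in\mathbb C$, and normalized if $\varphi(o)=1$. $\Gamma$ has property $(T_w)$ ("weakly Kazhdan") if it does not have the Haagerup property. $\alpha_w^*(\mathcal G)$ denotes the infimum of all $\alpha\in[0,1)$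 such that for every $\Gamma$-invariant bond percolation on $\mathcal G$ with $\mathbb E[\deg_\omega(o)]>\alpha\deg(o)$, $\tau(o,\cdot)$ does not vanish at infinity. For $\varepsilon>0$ and finite $K\subset\Gamma$, say that $(\varepsilon,K)$ satisfies (W) if every normalized positive definite function $\varphi$ on $\Gamma$ with $\min_{g\in K}\varphi(g)\ge1-\varepsilon$ (in particular $\varphi$ is real on $K$) does not vanish at infinity; such pairs exist when $\Gamma$ has $(T_w)$. Put $d_{K,\mathcal G}:=\max\{d(o,g):g\in K\}$, $\alpha_{\varepsilon,K,\mathcal G}:=1-\frac{\varepsilon}{\deg(o)\,d_{K,\mathcal G}}$ and $$\kappa_w(\mathcal G):=\inf\{\alpha_{\varepsilon,K,\mathcal G}:(\varepsilon,K)\text{ satisfies (W)}\}.$$ *)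

theory Defs
  imports "HOL-Probability.Probability" "HOL-Algebra.Generated_Groups"
    "HOL-Library.Extended_Real" "HOL-Library.Nonpos_Ints"
begin

section \<open>Positive definite functions and the Haagerup property\<close>

definition positive_definite :: "('a, 'b) monoid_scheme \<Rightarrow> ('a \<Rightarrow> complex) \<Rightarrow> bool" where
  "positive_definite G \<phi> \<longleftrightarrow>
     (\<forall>(n::nat) (x :: nat \<Rightarrow> 'a) (a :: nat \<Rightarrow> complex). (\<forall>i<n. x i \<in> carrier G) \<longrightarrow>
        (\<Sum>i<n. \<Sum>j<n. cnj (a i) * a j * \<phi> (inv\<^bsub>G\<^esub> (x i) \<otimes>\<^bsub>G\<^esub> x j)) \<in> \<real>\<^sub>\<ge>\<^sub>0)"

definition normalized_pd :: "('a, 'b) monoid_scheme \<Rightarrow> ('a \<Rightarrow> complex) \<Rightarrow> bool" where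
  "normalized_pd G \<phi> \<longleftrightarrow> positive_definite G \<phi> \<and> \<phi> \<one>\<^bsub>G\<^esub> = 1"

definition vanishes_at_infinity :: "('a, 'b) monoid_scheme \<Rightarrow> ('a \<Rightarrow> complex) \<Rightarrow> bool" where
  "vanishes_at_infinity G \<phi> \<longleftrightarrow> (\<forall>\<epsilon>>0. finite {g \<in> carrier G. \<epsilon> \<le> cmod (\<phi> g)})"

definition haagerup :: "('a, 'b) monoid_scheme \<Rightarrow> bool" where
  "haagerup G \<longleftrightarrow>
     (\<exists>\<phi> :: nat \<Rightarrow> 'a \<Rightarrow> complex.
        (\<forall>n. normalized_pd G (\<phi> n) \<and> vanishes_at_infinity G (\<phi> n)) \<and>
        (\<forall>g\<in>carrier G. (\<lambda>n. \<phi> n g) \<longlonglongrightarrow> 1))"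

definition weakly_kazhdan :: "('a, 'b) monoid_scheme \<Rightarrow> bool" where
  "weakly_kazhdan G \<longleftrightarrow> \<not> haagerup G"


section \<open>Right Cayley graphs\<close>

text \<open>
  An undirected edge is the set of its endpoints. If the identity lies in \<open>S\<close>, the loops are
  singletons, and a loop contributes 1 to the degree of its vertex.
\<close>

definition cayley_edges :: "('a, 'b) monoid_scheme \<Rightarrow> 'a set \<Rightarrow> 'a set set" where
  "cayley_edges G S = {{g, g \<otimes>\<^bsub>G\<^esub> s} |g s. g \<in> carrier G \<and> s \<in> S}"

definition adjacency :: "'a set set \<Rightarrow> ('a \<times> 'a) set" where
  "adjacency \<omega> = {(x, y). {x, y} \<in> \<omega>}"

definition degree_in :: "'a set set \<Rightarrow> 'a \<Rightarrow> nat" where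
  "degree_in \<omega> x = card {e \<in> \<omega>. x \<in> e}"

definition cayley_dist :: "('a, 'b) monoid_scheme \<Rightarrow> 'a set \<Rightarrow> 'a \<Rightarrow> 'a \<Rightarrow> nat" where
  "cayley_dist G S g h = (LEAST n. (g, h) \<in> adjacency (cayley_edges G S) ^^ n)"

definition cayley_deg :: "('a, 'b) monoid_scheme \<Rightarrow> 'a set \<Rightarrow> nat" where
  "cayley_deg G S = degree_in (cayley_edges G S) \<one>\<^bsub>G\<^esub>"


section \<open>Invariant bond percolation\<close>

text \<open>The product \<open>\<sigma>\<close>-algebra of \<open>{0,1}\<^sup>E\<close>, transported to the subsets of \<open>E\<close>.\<close>

definition config_space :: "'a set set \<Rightarrow> 'a set set measure" where
  "config_space E = sigma (Pow E) {{\<omega> \<in> Pow E. e \<in> \<omega>} |e. e \<in> E}"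

definition translate :: "('a, 'b) monoid_scheme \<Rightarrow> 'a \<Rightarrow> 'a set set \<Rightarrow> 'a set set" where
  "translate G g \<omega> = (\<lambda>e. (\<lambda>x. g \<otimes>\<^bsub>G\<^esub> x) ` e) ` \<omega>"

definition invariant_percolation ::
    "('a, 'b) monoid_scheme \<Rightarrow> 'a set \<Rightarrow> 'a set set measure \<Rightarrow> bool" where
  "invariant_percolation G S P \<longleftrightarrow>
     prob_space P \<and> sets P = sets (config_space (cayley_edges G S)) \<and>
     (\<forall>g\<in>carrier G. distr P P (translate G g) = P)"

definition two_point :: "'a set set measure \<Rightarrow> 'a \<Rightarrow> 'a \<Rightarrow> real" where
  "two_point P g h = measure P {\<omega> \<in> space P. (g, h) \<in> (adjacency \<omega>)\<^sup>*}"

definition two_point_vanishes ::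
    "('a, 'b) monoid_scheme \<Rightarrow> 'a set \<Rightarrow> 'a set set measure \<Rightarrow> bool" where
  "two_point_vanishes G S P \<longleftrightarrow>
     (\<lambda>r::nat. SUP (g, h)\<in>{(g, h). g \<in> carrier G \<and> h \<in> carrier G \<and> cayley_dist G S g h > r}.
        two_point P g h) \<longlonglongrightarrow> 0"


section \<open>The two thresholds\<close>

text \<open>
  Infima are taken in the extended reals, so that the infimum of the empty set is \<open>\<infinity>\<close>.
\<close>

definition alpha_w_star :: "('a, 'b) monoid_scheme \<Rightarrow> 'a set \<Rightarrow> ereal" where
  "alpha_w_star G S =
     Inf (ereal ` {\<alpha>. 0 \<le> \<alpha> \<and> \<alpha> < 1 \<and>
       (\<forall>P. invariant_percolation G S P \<longrightarrow>
          (\<integral>\<omega>. real (degree_in \<omega> \<one>\<^bsub>G\<^esub>) \<partial>P) > \<alpha> * real (cayley_deg G S) \<longrightarrow>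
          \<not> two_point_vanishes G S P)})"

text \<open>
  In an infinite group the indicator function of the identity is normalized, positive definite and
  vanishes at infinity. So a pair satisfying the following condition has \<open>\<epsilon> < 1\<close> and \<open>K\<close> contains
  an element other than the identity; in particular \<open>Max\<close> and the division in \<open>alpha_pair\<close> below
  are never applied to degenerate arguments.
\<close>

definition satisfies_W :: "('a, 'b) monoid_scheme \<Rightarrow> real \<Rightarrow> 'a set \<Rightarrow> bool" where
  "satisfies_W G \<epsilon> K \<longleftrightarrow> 0 < \<epsilon> \<and> finite K \<and> K \<subseteq> carrier G \<and>
     (\<forall>\<phi>. normalized_pd G \<phi> \<longrightarrow> (\<forall>g\<in>K. \<phi> g \<in> \<real> \<and> 1 - \<epsilon> \<le> Re (\<phi> g)) \<longrightarrow>
        \<not> vanishes_at_infinity G \<phi>)"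

definition cayley_radius :: "('a, 'b) monoid_scheme \<Rightarrow> 'a set \<Rightarrow> 'a set \<Rightarrow> nat" where
  "cayley_radius G S K = Max (cayley_dist G S \<one>\<^bsub>G\<^esub> ` K)"

definition alpha_pair :: "('a, 'b) monoid_scheme \<Rightarrow> 'a set \<Rightarrow> real \<Rightarrow> 'a set \<Rightarrow> real" where
  "alpha_pair G S \<epsilon> K = 1 - \<epsilon> / (real (cayley_deg G S) * real (cayley_radius G S K))"

definition kappa_w :: "('a, 'b) monoid_scheme \<Rightarrow> 'a set \<Rightarrow> ereal" where
  "kappa_w G S = Inf {ereal (alpha_pair G S \<epsilon> K) |\<epsilon> K. satisfies_W G \<epsilon> K}"

end

theory Submission imports Defs begin

text \<open>
  For an invariant percolation, \<open>g \<mapsto> \<tau>(o, g)\<close> is a normalized positive definite function: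
  by invariance \<open>\<tau>(o, g\<inverse>h) = \<tau>(g, h)\<close>, and the latter is the average of the indicators of the
  cluster partitions. An edge is closed with probability at most \<open>\<delta> = deg(o) - E[deg\<^sub>\<omega>(o)]\<close>, so a
  union bound along a geodesic gives \<open>\<tau>(o, g) \<ge> 1 - \<delta> d(o, g)\<close>. If \<open>(\<epsilon>, K)\<close> satisfies (W) and
  \<open>E[deg\<^sub>\<omega>(o)] > \<alpha> deg(o)\<close> with \<open>\<alpha>\<close> given by \<open>(\<epsilon>, K)\<close>, then \<open>\<delta> d(o, g) \<le> \<epsilon>\<close> on \<open>K\<close>, and (W)
  shows that \<open>\<tau>\<close> does not vanish at infinity.
\<close>

section \<open>Positivity of the kernel of a partition\<close>

text \<open>The quadratic form splits over the blocks of the partition into level sets of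
  \<open>c\<close>; the block with label \<open>v\<close> contributes the squared modulus of its
  coefficient sum \<open>?b v\<close>.\<close>

lemma sum_partition_nonneg:
  fixes a :: "nat \<Rightarrow> complex" and c :: "nat \<Rightarrow> 'c"
  shows "(\<Sum>i<n. \<Sum>j<n. cnj (a i) * a j * of_bool (c i = c j)) \<in> \<real>\<^sub>\<ge>\<^sub>0"
proof -
  let ?b = "\<lambda>v. \<Sum>i<n. a i * of_bool (c i = v)"
  have "(\<Sum>i<n. \<Sum>j<n. cnj (a i) * a j * of_bool (c i = c j)) =
      (\<Sum>i<n. \<Sum>j<n. \<Sum>v\<in>c ` {..<n}. cnj (a i * of_bool (c i = v)) * (a j * of_bool (c j = v)))"
  proof (intro sum.cong refl)
    fix i j assume "i \<in> {..<n}" "j \<in> {..<n}"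
    \<comment> \<open>Only the label \<open>v = c i\<close> survives, and it occurs in the range of
      summation.\<close>
    have "(\<Sum>v\<in>c ` {..<n}. cnj (a i * of_bool (c i = v)) * (a j * of_bool (c j = v))) =
        (\<Sum>v\<in>c ` {..<n}. if c i = v then cnj (a i) * a j * of_bool (c i = c j) else 0)"
      by (intro sum.cong) auto
    also have "\<dots> = cnj (a i) * a j * of_bool (c i = c j)"
      using \<open>i \<in> {..<n}\<close> by (subst sum.delta') auto
    finally show "cnj (a i) * a j * of_bool (c i = c j) =
        (\<Sum>v\<in>c ` {..<n}. cnj (a i * of_bool (c i = v)) * (a j * of_bool (c j = v)))" ..
  qed
  also have "\<dots> = (\<Sum>v\<in>c ` {..<n}. \<Sum>i<n. \<Sum>j<n.
      cnj (a i * of_bool (c i = v)) * (a j * of_bool (c j = v)))"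
    by (simp only: sum.swap[where A = "c ` {..<n}" and B = "{..<n}"])
  also have "\<dots> = (\<Sum>v\<in>c ` {..<n}. cnj (?b v) * ?b v)"
    by (simp only: sum_product cnj_sum)
  also have "\<dots> = complex_of_real (\<Sum>v\<in>c ` {..<n}. (cmod (?b v))\<^sup>2)"
    unfolding of_real_sum by (intro sum.cong refl, subst complex_norm_square) (rule mult.commute)
  also have "\<dots> \<in> \<real>\<^sub>\<ge>\<^sub>0"
    by (simp only: nonneg_Reals_of_real_iff) (intro sum_nonneg zero_le_power2)
  finally show ?thesis .
qed

section \<open>Clusters as equivalence classes\<close>

lemma adjacency_rtrancl_sym: "(x, y) \<in> (adjacency \<omega>)\<^sup>* \<Longrightarrow> (y, x) \<in> (adjacency \<omega>)\<^sup>*"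
proof -
  have "sym (adjacency \<omega>)"
    by (simp add: sym_def adjacency_def insert_commute)
  then show "(x, y) \<in> (adjacency \<omega>)\<^sup>* \<Longrightarrow> (y, x) \<in> (adjacency \<omega>)\<^sup>*"
    by (rule symD[OF sym_rtrancl])
qed

text \<open>Reachability is an equivalence relation. Expressing it as equality of labels makes
  \<open>sum_partition_nonneg\<close> applicable with clusters as labels.\<close>

lemma connected_iff_cluster_eq:
  "(x, y) \<in> (adjacency \<omega>)\<^sup>* \<longleftrightarrow> (adjacency \<omega>)\<^sup>* `` {x} = (adjacency \<omega>)\<^sup>* `` {y}"
    (is "_ \<longleftrightarrow> ?R `` {x} = ?R `` {y}")
proof
  assume xy: "(x, y) \<in> ?R"
  show "?R `` {x} = ?R `` {y}"
    using rtrancl_trans[OF xy] rtrancl_trans[OF adjacency_rtrancl_sym[OF xy]] by blast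
next
  assume "?R `` {x} = ?R `` {y}"
  moreover have "y \<in> ?R `` {y}" by simp
  ultimately show "(x, y) \<in> ?R" by blast
qed

section \<open>Nondegeneracy of pairs satisfying (W)\<close>

context group
begin

text \<open>The kernel \<open>inv x \<otimes> y = \<one>\<close> is equality of \<open>x\<close> and
  \<open>y\<close>, so this is the partition of the indices by the values of
  \<open>x\<close>.\<close>

lemma normalized_pd_indicator_one: "normalized_pd G (\<lambda>g. of_bool (g = \<one>))"
proof -
  have eq: "inv x \<otimes> y = \<one> \<longleftrightarrow> x = y" if "x \<in> carrier G" "y \<in> carrier G" for x y
    using that by (auto simp: inv_solve_left')
  have "(\<Sum>i<n. \<Sum>j<n. cnj (a i) * a j * of_bool (inv x i \<otimes> x j = \<one>)) =
      (\<Sum>i<n. \<Sum>j<n. cnj (a i) * a j * of_bool (x i = x j))"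
    if "\<forall>i<n. x i \<in> carrier G" for n and x :: "nat \<Rightarrow> 'a" and a :: "nat \<Rightarrow> complex"
    using that by (intro sum.cong refl) (simp add: eq)
  then show ?thesis
    unfolding normalized_pd_def positive_definite_def
    by (simp add: sum_partition_nonneg del: sum_mult_of_bool_eq)
qed

lemma vanishes_at_infinity_indicator_one: "vanishes_at_infinity G (\<lambda>g. of_bool (g = \<one>))"
  unfolding vanishes_at_infinity_def
proof (intro allI impI)
  fix \<epsilon> :: real assume "0 < \<epsilon>"
  then have "{g \<in> carrier G. \<epsilon> \<le> cmod (of_bool (g = \<one>))} \<subseteq> {\<one>}"
    by (auto simp: of_bool_def split: if_splits)
  then show "finite {g \<in> carrier G. \<epsilon> \<le> cmod (of_bool (g = \<one>))}"
    by (rule finite_subset) simp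
qed

text \<open>Test (W) on the indicator of the identity: it vanishes at infinity, so it must violate
  the lower bound somewhere on \<open>K\<close>. This cannot happen at the identity, where its value
  is 1; elsewhere its value is 0, which forces \<open>1 - \<epsilon> > 0\<close>.\<close>

lemma satisfies_W_nondegenerate:
  assumes "satisfies_W G \<epsilon> K"
  shows "\<epsilon> < 1" "\<exists>g\<in>K. g \<noteq> \<one>"
proof -
  have "\<not> (\<forall>g\<in>K. of_bool (g = \<one>) \<in> (\<real> :: complex set) \<and> 1 - \<epsilon> \<le> Re (of_bool (g = \<one>)))"
    using assms normalized_pd_indicator_one vanishes_at_infinity_indicator_one
    unfolding satisfies_W_def by blast
  then obtain g where "g \<in> K" "\<not> 1 - \<epsilon> \<le> Re (of_bool (g = \<one>))"
    by (auto simp: of_bool_def split: if_splits)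
  moreover have "0 < \<epsilon>"
    using assms by (simp add: satisfies_W_def)
  ultimately show "\<epsilon> < 1" "\<exists>g\<in>K. g \<noteq> \<one>"
    by (auto simp: of_bool_def split: if_splits)
qed

end

section \<open>Geometry of the Cayley graph\<close>

locale cayley_graph = group G for G (structure) +
  fixes S :: "'a set"
  assumes finite_S: "finite S" and S_subset: "S \<subseteq> carrier G"
    and S_inv: "s \<in> S \<Longrightarrow> inv s \<in> S" and generate_S: "generate G S = carrier G"
begin

abbreviation E where "E \<equiv> cayley_edges G S"

lemma edge_carrier: "e \<in> E \<Longrightarrow> e \<subseteq> carrier G"
  using S_subset by (auto simp: cayley_edges_def)

text \<open>Edges carry no orientation, so \<open>x\<close> may be either endpoint of the generating
  pair; in the reversed case the inverse generator leads from \<open>x\<close> to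
  \<open>y\<close>.\<close>

lemma edgeE:
  assumes "{x, y} \<in> E"
  obtains s where "s \<in> S" "x \<in> carrier G" "y = x \<otimes> s"
proof -
  obtain g s where gs: "{x, y} = {g, g \<otimes> s}" "g \<in> carrier G" "s \<in> S"
    using assms by (auto simp: cayley_edges_def)
  have s: "s \<in> carrier G" "inv s \<in> S"
    using gs(3) S_subset S_inv by auto
  from gs(1) consider "x = g" "y = g \<otimes> s" | "x = g \<otimes> s" "y = g"
    by (auto simp: doubleton_eq_iff)
  then show ?thesis
  proof cases
    case 1
    then show ?thesis using that gs by blast
  next
    case 2
    then show ?thesis
      using gs s by (intro that[of "inv s"]) (simp_all add: m_assoc)
  qed
qed

lemma edges_at_one: "{e \<in> E. \<one> \<in> e} = (\<lambda>s. {\<one>, s}) ` S"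
proof (intro equalityI subsetI)
  fix e assume "e \<in> {e \<in> E. \<one> \<in> e}"
  moreover from this obtain g s where "e = {g, g \<otimes> s}"
    by (auto simp: cayley_edges_def)
  ultimately have "\<exists>y. e = {\<one>, y} \<and> {\<one>, y} \<in> E"
    by (metis (no_types, lifting) insertE insert_commute mem_Collect_eq singletonD)
  then obtain y where e: "e = {\<one>, y}" "{\<one>, y} \<in> E"
    by blast
  then obtain s where "s \<in> S" "y = \<one> \<otimes> s"
    by (auto elim: edgeE)
  then show "e \<in> (\<lambda>s. {\<one>, s}) ` S"
    using e S_subset by auto
next
  fix e assume "e \<in> (\<lambda>s. {\<one>, s}) ` S"
  then obtain s where "s \<in> S" "e = {\<one>, \<one> \<otimes> s}"
    using S_subset by force
  then show "e \<in> {e \<in> E. \<one> \<in> e}"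
    unfolding cayley_edges_def by blast
qed

lemma connected: "g \<in> carrier G \<Longrightarrow> (\<one>, g) \<in> (adjacency E)\<^sup>*"
proof -
  have step: "(x, x \<otimes> s) \<in> adjacency E" if "x \<in> carrier G" "s \<in> S" for x s
    using that by (auto simp: adjacency_def cayley_edges_def)
  \<comment> \<open>The starting point is arbitrary because, for a product, the path of the second
    factor starts at \<open>x \<otimes> h1\<close>.\<close>
  have "(x, x \<otimes> h) \<in> (adjacency E)\<^sup>*" if "h \<in> generate G S" "x \<in> carrier G" for x h
    using that
  proof (induction arbitrary: x)
    case (eng h1 h2)
    then have "h1 \<in> carrier G" "h2 \<in> carrier G"
      using generate_S by auto
    then show ?case
      using eng.IH(1)[of x] eng.IH(2)[of "x \<otimes> h1"] eng.prems
      by (auto simp: m_assoc intro: rtrancl_trans)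
  qed (auto intro: step S_inv)
  from this[of g \<one>] show "g \<in> carrier G \<Longrightarrow> (\<one>, g) \<in> (adjacency E)\<^sup>*"
    by (simp add: generate_S)
qed

text \<open>Connectedness makes the set of walk lengths nonempty, so the \<open>LEAST\<close> in the
  distance is attained.\<close>

lemma cayley_dist_path:
  assumes "g \<in> carrier G"
  shows "(\<one>, g) \<in> adjacency E ^^ cayley_dist G S \<one> g"
  unfolding cayley_dist_def using connected[OF assms] by (metis LeastI rtrancl_imp_relpow)

text \<open>These are the endpoints of walks of length exactly \<open>n\<close>, a set containing
  the sphere of radius \<open>n\<close>. Each step has only finitely many generators to choose
  from.\<close>

lemma finite_sphere: "finite {g. (\<one>, g) \<in> adjacency E ^^ n}"
proof (induction n)
  case (Suc n)
  have "{g. (\<one>, g) \<in> adjacency E ^^ Suc n} \<subseteq>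
      (\<lambda>(y, s). y \<otimes> s) ` ({g. (\<one>, g) \<in> adjacency E ^^ n} \<times> S)"
    by (force simp: adjacency_def elim: edgeE)
  then show ?case
    by (rule finite_subset) (intro finite_imageI finite_cartesian_product Suc finite_S)
qed simp

text \<open>This links decay in the graph distance to the finite superlevel sets in
  \<open>vanishes_at_infinity\<close>.\<close>

lemma finite_ball: "finite {g \<in> carrier G. cayley_dist G S \<one> g \<le> r}"
proof (rule finite_subset)
  show "{g \<in> carrier G. cayley_dist G S \<one> g \<le> r} \<subseteq> (\<Union>n\<le>r. {g. (\<one>, g) \<in> adjacency E ^^ n})"
    using cayley_dist_path by auto
qed (auto simp: finite_sphere)

lemma countable_carrier: "countable (carrier G)"
proof (rule countable_subset)
  show "carrier G \<subseteq> (\<Union>n. {g. (\<one>, g) \<in> adjacency E ^^ n})"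
    using cayley_dist_path by auto
qed (auto intro: countable_finite finite_sphere)

lemma cayley_dist_pos: "g \<in> carrier G \<Longrightarrow> g \<noteq> \<one> \<Longrightarrow> 0 < cayley_dist G S \<one> g"
  using cayley_dist_path[of g] by (auto intro!: gr0I)

lemma cayley_deg_pos:
  assumes "infinite (carrier G)"
  shows "0 < cayley_deg G S"
proof -
  \<comment> \<open>The empty set generates only the trivial group, which is finite.\<close>
  have "S \<noteq> {}"
    using assms generate_S generate_empty by (metis finite.emptyI finite.insertI)
  then show ?thesis
    unfolding cayley_deg_def degree_in_def edges_at_one using finite_S by (simp add: card_gt_0_iff)
qed

section \<open>Left translation of edges and configurations\<close>

lemma translate_edge:
  assumes "g \<in> carrier G" "e \<in> E"
  shows "(\<otimes>) g ` e \<in> E"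
proof -
  obtain h s where hs: "e = {h, h \<otimes> s}" "h \<in> carrier G" "s \<in> S"
    using assms by (auto simp: cayley_edges_def)
  then have "(\<otimes>) g ` e = {g \<otimes> h, (g \<otimes> h) \<otimes> s}"
    using assms S_subset by (auto simp: m_assoc)
  moreover have "g \<otimes> h \<in> carrier G"
    using assms hs by simp
  ultimately show ?thesis
    using hs unfolding cayley_edges_def by blast
qed

lemma translate_subset: "g \<in> carrier G \<Longrightarrow> \<omega> \<subseteq> E \<Longrightarrow> translate G g \<omega> \<subseteq> E"
  using translate_edge by (auto simp: translate_def)

lemma image_inv_image:
  assumes "g \<in> carrier G" "e \<subseteq> carrier G"
  shows "(\<otimes>) (inv g) ` (\<otimes>) g ` e = e" "(\<otimes>) g ` (\<otimes>) (inv g) ` e = e"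
proof -
  have "inv g \<otimes> (g \<otimes> x) = x" "g \<otimes> (inv g \<otimes> x) = x" if "x \<in> e" for x
    using that assms by (auto simp: m_assoc[symmetric])
  then show "(\<otimes>) (inv g) ` (\<otimes>) g ` e = e" "(\<otimes>) g ` (\<otimes>) (inv g) ` e = e"
    by (simp_all add: image_image)
qed

text \<open>With this, the preimage of an open-edge event under a translation is again an open-edge
  event.\<close>

lemma mem_translate_iff:
  assumes "g \<in> carrier G" "\<omega> \<subseteq> E" "e \<in> E"
  shows "e \<in> translate G g \<omega> \<longleftrightarrow> (\<otimes>) (inv g) ` e \<in> \<omega>"
proof
  assume "e \<in> translate G g \<omega>"
  then obtain e' where "e' \<in> \<omega>" "e = (\<otimes>) g ` e'"
    by (auto simp: translate_def)
  then show "(\<otimes>) (inv g) ` e \<in> \<omega>"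
    using assms edge_carrier[of e'] image_inv_image(1)[of g e'] by auto
next
  assume "(\<otimes>) (inv g) ` e \<in> \<omega>"
  then have "(\<otimes>) g ` (\<otimes>) (inv g) ` e \<in> translate G g \<omega>"
    unfolding translate_def by blast
  then show "e \<in> translate G g \<omega>"
    using assms edge_carrier[of e] image_inv_image(2)[of g e] by auto
qed

lemma connected_translate:
  assumes "(x, y) \<in> (adjacency \<omega>)\<^sup>*"
  shows "(g \<otimes> x, g \<otimes> y) \<in> (adjacency (translate G g \<omega>))\<^sup>*"
  using assms
proof induction
  case (step y z)
  then have "(g \<otimes> y, g \<otimes> z) \<in> adjacency (translate G g \<omega>)"
    by (auto simp: adjacency_def translate_def intro!: image_eqI[of _ _ "{y, z}"])
  with step.IH show ?case by (rule rtrancl_into_rtrancl)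
qed simp

lemma translate_inv_translate:
  assumes "g \<in> carrier G" "\<omega> \<subseteq> E"
  shows "translate G (inv g) (translate G g \<omega>) = \<omega>"
proof -
  have "(\<otimes>) (inv g) ` (\<otimes>) g ` e = e" if "e \<in> \<omega>" for e
    using that assms edge_carrier by (intro image_inv_image) auto
  then show ?thesis
    by (simp add: translate_def image_image)
qed

lemma connected_translate_iff:
  assumes "g \<in> carrier G" "\<omega> \<subseteq> E" "x \<in> carrier G" "y \<in> carrier G"
  shows "(g \<otimes> x, g \<otimes> y) \<in> (adjacency (translate G g \<omega>))\<^sup>* \<longleftrightarrow> (x, y) \<in> (adjacency \<omega>)\<^sup>*"
proof
  assume "(g \<otimes> x, g \<otimes> y) \<in> (adjacency (translate G g \<omega>))\<^sup>*"
  \<comment> \<open>The converse is the forward implication for \<open>inv g\<close>, which undoes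
    the translation.\<close>
  from connected_translate[OF this, of "inv g"] show "(x, y) \<in> (adjacency \<omega>)\<^sup>*"
    using assms by (simp add: translate_inv_translate m_assoc[symmetric])
qed (rule connected_translate)

end

section \<open>Measurability and invariance of connection events\<close>

locale cayley_percolation = cayley_graph +
  fixes P :: "'a set set measure"
  assumes invariant: "invariant_percolation G S P"
begin

sublocale prob_space P
  using invariant by (simp add: invariant_percolation_def)

lemma sets_P: "sets P = sets (config_space E)"
  using invariant by (simp add: invariant_percolation_def)

lemma space_P: "space P = Pow E"
  using sets_eq_imp_space_eq[OF sets_P] by (simp add: config_space_def space_measure_of_conv)

lemma open_edge_event [measurable]: "{\<omega> \<in> space P. e \<in> \<omega>} \<in> events"
proof (cases "e \<in> E")
  case True
  then show ?thesis
    unfolding sets_P space_P config_space_def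
    by (subst sets_measure_of) (auto intro: sigma_sets.Basic)
next
  case False
  then have "{\<omega> \<in> space P. e \<in> \<omega>} = {}"
    by (auto simp: space_P)
  then show ?thesis by (simp only: sets.empty_sets)
qed

text \<open>Split a walk at its penultimate vertex \<open>z\<close>. As an endpoint of an edge,
  \<open>z\<close> lies in the countable carrier, so the union stays measurable.\<close>

lemma relpow_event: "{\<omega> \<in> space P. (x, y) \<in> adjacency \<omega> ^^ n} \<in> events"
proof (induction n arbitrary: y)
  case (Suc n)
  have "{\<omega> \<in> space P. (x, y) \<in> adjacency \<omega> ^^ Suc n} =
      (\<Union>z\<in>carrier G. {\<omega> \<in> space P. (x, z) \<in> adjacency \<omega> ^^ n} \<inter> {\<omega> \<in> space P. {z, y} \<in> \<omega>})"
    using edge_carrier by (auto simp: adjacency_def space_P)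
  then show ?case
    using Suc open_edge_event countable_carrier by (auto intro!: sets.countable_UN')
qed simp

lemma connected_event [measurable]: "{\<omega> \<in> space P. (x, y) \<in> (adjacency \<omega>)\<^sup>*} \<in> events"
proof -
  have "{\<omega> \<in> space P. (x, y) \<in> (adjacency \<omega>)\<^sup>*} = (\<Union>n. {\<omega> \<in> space P. (x, y) \<in> adjacency \<omega> ^^ n})"
    by (auto simp: rtrancl_power)
  then show ?thesis using relpow_event by auto
qed

text \<open>It suffices to check the generating events \<open>e \<in> \<omega>\<close>, whose
  preimages say that the edge translated by \<open>inv g\<close> is open.\<close>

lemma translate_measurable:
  assumes "g \<in> carrier G"
  shows "translate G g \<in> measurable P P"
proof -
  have "translate G g \<in> measurable P (config_space E)"
    unfolding config_space_def
  proof (rule measurable_measure_of)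
    show "translate G g \<in> space P \<rightarrow> Pow E"
      using translate_subset[OF assms] by (auto simp: space_P)
  next
    fix A assume "A \<in> {{\<omega> \<in> Pow E. e \<in> \<omega>} |e. e \<in> E}"
    then obtain e where e: "A = {\<omega> \<in> Pow E. e \<in> \<omega>}" "e \<in> E" by auto
    have "translate G g -` A \<inter> space P = {\<omega> \<in> space P. (\<otimes>) (inv g) ` e \<in> \<omega>}"
      using e assms translate_subset[OF assms] mem_translate_iff[OF assms]
      by (auto simp: space_P)
    then show "translate G g -` A \<inter> space P \<in> events" by simp
  qed auto
  then show ?thesis
    by (simp cong: measurable_cong_sets add: sets_P)
qed

lemma prob_translate:
  assumes "g \<in> carrier G" "A \<in> events"
  shows "prob (translate G g -` A \<inter> space P) = prob A"
proof -
  have "prob A = measure (distr P P (translate G g)) A"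
    using invariant assms by (simp add: invariant_percolation_def)
  then show ?thesis
    using measure_distr[OF translate_measurable[OF assms(1)] assms(2)] by simp
qed

lemma two_point_translate:
  assumes "g \<in> carrier G" "x \<in> carrier G" "y \<in> carrier G"
  shows "two_point P (g \<otimes> x) (g \<otimes> y) = two_point P x y"
proof -
  have eq: "translate G g -` {\<omega> \<in> space P. (g \<otimes> x, g \<otimes> y) \<in> (adjacency \<omega>)\<^sup>*} \<inter> space P =
      {\<omega> \<in> space P. (x, y) \<in> (adjacency \<omega>)\<^sup>*}"
    using assms translate_subset[OF assms(1)] connected_translate_iff[OF assms(1)]
    by (auto simp: space_P)
  show ?thesis
    using prob_translate[OF assms(1) connected_event, of "g \<otimes> x" "g \<otimes> y"]
    unfolding eq two_point_def by (rule sym)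
qed

lemma prob_edge_translate:
  assumes "g \<in> carrier G" "e \<in> E"
  shows "prob {\<omega> \<in> space P. (\<otimes>) g ` e \<in> \<omega>} = prob {\<omega> \<in> space P. e \<in> \<omega>}"
proof -
  have eq: "translate G g -` {\<omega> \<in> space P. (\<otimes>) g ` e \<in> \<omega>} \<inter> space P = {\<omega> \<in> space P. e \<in> \<omega>}"
    using assms translate_subset[OF assms(1)] mem_translate_iff[OF assms(1)]
      translate_edge[OF assms] image_inv_image(1)[OF assms(1) edge_carrier[OF assms(2)]]
    by (auto simp: space_P)
  show ?thesis
    using prob_translate[OF assms(1) open_edge_event, of "(\<otimes>) g ` e"]
    unfolding eq by (rule sym)
qed

section \<open>The two-point function as a positive definite function\<close>

lemma normalized_pd_two_point: "normalized_pd G (\<lambda>g. complex_of_real (two_point P \<one> g))"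
proof -
  have "(\<Sum>i<n. \<Sum>j<n. cnj (a i) * a j * complex_of_real (two_point P \<one> (inv x i \<otimes> x j))) \<in> \<real>\<^sub>\<ge>\<^sub>0"
    if x: "\<forall>i<n. x i \<in> carrier G" for n and x :: "nat \<Rightarrow> 'a" and a :: "nat \<Rightarrow> complex"
  proof -
    \<comment> \<open>\<open>F \<omega>\<close> is the quadratic form of the cluster partition of
      the single configuration \<open>\<omega>\<close>; its expectation is the quadratic form of the
      two-point function.\<close>
    define f :: "nat \<Rightarrow> nat \<Rightarrow> 'a set set \<Rightarrow> complex" where
      "f i j \<omega> = complex_of_real (indicator {\<omega> \<in> space P. (x i, x j) \<in> (adjacency \<omega>)\<^sup>*} \<omega>)"
      for i j \<omega>
    define F where "F \<omega> = (\<Sum>i<n. \<Sum>j<n. cnj (a i) * a j * f i j \<omega>)" for \<omega>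
    have tau: "two_point P \<one> (inv x i \<otimes> x j) = two_point P (x i) (x j)" if "i < n" "j < n" for i j
    proof -
      have "x i \<in> carrier G" "x j \<in> carrier G"
        using x that by auto
      then show ?thesis
        using two_point_translate[of "inv x i" "x i" "x j"] by (simp only: l_inv inv_closed)
    qed
    have f_int: "integrable P (f i j)" for i j
      unfolding f_def
      by (intro integrable_of_real integrable_real_indicator connected_event)
        (simp add: emeasure_eq_measure)
    have f_eq: "expectation (f i j) = complex_of_real (two_point P (x i) (x j))" for i j
      unfolding f_def two_point_def integral_complex_of_real by simp
    have F_nonneg: "F \<omega> \<in> \<real>\<^sub>\<ge>\<^sub>0" if "\<omega> \<in> space P" for \<omega>
      using sum_partition_nonneg[of a "\<lambda>i. (adjacency \<omega>)\<^sup>* `` {x i}" n] that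
      by (simp add: F_def f_def indicator_def of_bool_def if_distrib[of complex_of_real]
          flip: connected_iff_cluster_eq cong: if_cong)
    \<comment> \<open>Nonnegative values are real, so the complex expectation reduces to a real one,
      whose positivity follows from that of the integrand.\<close>
    then have "expectation F = expectation (\<lambda>\<omega>. complex_of_real (Re (F \<omega>)))"
      by (intro Bochner_Integration.integral_cong refl)
        (simp add: complex_nonneg_Reals_iff complex_eq_iff)
    also have "\<dots> = complex_of_real (expectation (\<lambda>\<omega>. Re (F \<omega>)))"
      by (rule integral_complex_of_real)
    also have "\<dots> \<in> \<real>\<^sub>\<ge>\<^sub>0"
      using F_nonneg
      by (auto simp: complex_nonneg_Reals_iff intro!: Bochner_Integration.integral_nonneg)
    also have "expectation F =
        (\<Sum>i<n. \<Sum>j<n. cnj (a i) * a j * complex_of_real (two_point P (x i) (x j)))"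
      unfolding F_def
      by (simp add: f_int f_eq)
    finally show ?thesis
      using tau by simp
  qed
  moreover have "two_point P \<one> \<one> = 1"
    by (simp add: two_point_def prob_space)
  ultimately show ?thesis
    unfolding normalized_pd_def positive_definite_def by simp
qed

text \<open>Specialize the supremum over distant pairs to pairs based at the identity: points where
  the function is at least \<open>\<epsilon>\<close> then lie in a ball, which is finite.\<close>

lemma vanishes_at_infinity_two_point:
  assumes "two_point_vanishes G S P"
  shows "vanishes_at_infinity G (\<lambda>g. complex_of_real (two_point P \<one> g))"
  unfolding vanishes_at_infinity_def
proof (intro allI impI)
  fix \<epsilon> :: real assume "0 < \<epsilon>"
  let ?A = "\<lambda>r. {(g, h). g \<in> carrier G \<and> h \<in> carrier G \<and> cayley_dist G S g h > r}"
  have "eventually (\<lambda>r. (SUP (g, h)\<in>?A r. two_point P g h) < \<epsilon>) sequentially"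
    using order_tendstoD(2)[OF assms[unfolded two_point_vanishes_def] \<open>0 < \<epsilon>\<close>] .
  then obtain r where r: "(SUP (g, h)\<in>?A r. two_point P g h) < \<epsilon>"
    by (auto simp: eventually_sequentially)
  have "two_point P \<one> g < \<epsilon>" if "g \<in> carrier G" "r < cayley_dist G S \<one> g" for g
  proof -
    \<comment> \<open>A real supremum dominates its members only for a bounded family; probabilities
      are bounded by 1.\<close>
    have "bdd_above ((\<lambda>(g, h). two_point P g h) ` ?A r)"
      by (intro bdd_aboveI2[where M = 1]) (auto simp: two_point_def)
    from cSUP_upper[OF _ this, of "(\<one>, g)"] r show ?thesis
      using that by auto
  qed
  then have "{g \<in> carrier G. \<epsilon> \<le> cmod (complex_of_real (two_point P \<one> g))} \<subseteq>
      {g \<in> carrier G. cayley_dist G S \<one> g \<le> r}"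
    by (force simp: two_point_def)
  then show "finite {g \<in> carrier G. \<epsilon> \<le> cmod (complex_of_real (two_point P \<one> g))}"
    using finite_ball finite_subset by blast
qed

section \<open>Lower bound for the two-point function\<close>

text \<open>This is the \<delta> of the overview: the expected number of closed edges at the
  identity.\<close>

definition deficit :: real where
  "deficit = real (cayley_deg G S) - expectation (\<lambda>\<omega>. real (degree_in \<omega> \<one>))"

lemma deficit_eq: "deficit = (\<Sum>e\<in>{e \<in> E. \<one> \<in> e}. 1 - prob {\<omega> \<in> space P. e \<in> \<omega>})"
proof -
  let ?D = "{e \<in> E. \<one> \<in> e}"
  have fin: "finite ?D"
    unfolding edges_at_one using finite_S by simp
  have "real (degree_in \<omega> \<one>) = (\<Sum>e\<in>?D. indicator {\<omega> \<in> space P. e \<in> \<omega>} \<omega>)" if "\<omega> \<in> space P" for \<omega>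
  proof -
    have "{e \<in> \<omega>. \<one> \<in> e} = {e \<in> ?D. e \<in> \<omega>}"
      using that by (auto simp: space_P)
    then show ?thesis
      using fin that by (simp add: degree_in_def indicator_def sum.If_cases Collect_conj_eq Int_assoc)
  qed
  then have "expectation (\<lambda>\<omega>. real (degree_in \<omega> \<one>)) =
      expectation (\<lambda>\<omega>. \<Sum>e\<in>?D. indicator {\<omega> \<in> space P. e \<in> \<omega>} \<omega>)"
    by (intro Bochner_Integration.integral_cong refl)
  also have "\<dots> = (\<Sum>e\<in>?D. prob {\<omega> \<in> space P. e \<in> \<omega>})"
    by (subst Bochner_Integration.integral_sum)
      (auto simp: emeasure_eq_measure intro!: integrable_real_indicator)
  finally show ?thesis
    by (simp add: deficit_def cayley_deg_def degree_in_def sum_subtractf)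
qed

text \<open>Every edge is a translate of an edge at the identity, whose probability of being closed
  is one of the nonnegative summands of \<open>deficit\<close>.\<close>

lemma prob_edge_ge:
  assumes "e \<in> E"
  shows "1 - deficit \<le> prob {\<omega> \<in> space P. e \<in> \<omega>}"
proof -
  obtain g s where gs: "e = {g, g \<otimes> s}" "g \<in> carrier G" "s \<in> S"
    using assms by (auto simp: cayley_edges_def)
  have s: "{\<one>, s} \<in> {e \<in> E. \<one> \<in> e}"
    unfolding edges_at_one using gs by blast
  have "1 - prob {\<omega> \<in> space P. {\<one>, s} \<in> \<omega>} \<le> deficit"
    unfolding deficit_eq by (rule member_le_sum[OF s]) (auto simp: edges_at_one finite_S)
  moreover have "e = (\<otimes>) g ` {\<one>, s}"
    using gs by simp
  ultimately show ?thesis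
    using prob_edge_translate[OF gs(2), of "{\<one>, s}"] s by simp
qed

lemma deficit_nonneg: "0 \<le> deficit"
  unfolding deficit_eq by (intro sum_nonneg) simp

lemma two_point_ge_relpow:
  "(x, y) \<in> adjacency E ^^ n \<Longrightarrow> 1 - real n * deficit \<le> two_point P x y"
proof (induction n arbitrary: y)
  case 0
  then show ?case by (simp add: two_point_def prob_space)
next
  case (Suc n)
  then obtain z where z: "(x, z) \<in> adjacency E ^^ n" "{z, y} \<in> E"
    by (auto simp: adjacency_def)
  let ?A = "{\<omega> \<in> space P. (x, z) \<in> (adjacency \<omega>)\<^sup>*}" and ?B = "{\<omega> \<in> space P. {z, y} \<in> \<omega>}"
    and ?C = "{\<omega> \<in> space P. (x, y) \<in> (adjacency \<omega>)\<^sup>*}"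
  \<comment> \<open>If \<open>x\<close> is connected to \<open>z\<close>, then either it is
    connected to \<open>y\<close> or the last edge is closed. Each step of the walk thus costs at
    most \<open>deficit\<close>.\<close>
  have "prob ?A \<le> prob (?C \<union> (space P - ?B))"
    by (intro finite_measure_mono sets.Un sets.Diff connected_event open_edge_event sets.top)
      (auto simp: adjacency_def intro: rtrancl_into_rtrancl)
  also have "\<dots> \<le> prob ?C + prob (space P - ?B)"
    by (intro measure_Un_le sets.Diff connected_event open_edge_event sets.top)
  also have "prob (space P - ?B) = 1 - prob ?B"
    by (rule prob_compl[OF open_edge_event])
  finally show ?case
    using Suc.IH[OF z(1)] prob_edge_ge[OF z(2)] by (simp add: two_point_def algebra_simps)
qed

lemma two_point_ge:
  assumes "g \<in> carrier G"
  shows "1 - real (cayley_dist G S \<one> g) * deficit \<le> two_point P \<one> g"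
  by (rule two_point_ge_relpow[OF cayley_dist_path[OF assms]])

section \<open>From (W) to the threshold inequality\<close>

lemma not_two_point_vanishes:
  assumes W: "satisfies_W G \<epsilon> K" and deg: "0 < cayley_deg G S" and rad: "0 < cayley_radius G S K"
    and large: "expectation (\<lambda>\<omega>. real (degree_in \<omega> \<one>)) > alpha_pair G S \<epsilon> K * real (cayley_deg G S)"
  shows "\<not> two_point_vanishes G S P"
proof
  assume "two_point_vanishes G S P"
  then have vanish: "vanishes_at_infinity G (\<lambda>g. complex_of_real (two_point P \<one> g))"
    by (rule vanishes_at_infinity_two_point)
  have K: "finite K" "K \<subseteq> carrier G"
    using W by (auto simp: satisfies_W_def)
  \<comment> \<open>The degree cancels: \<alpha> times the degree equals the degree minus \<epsilon>
    divided by the radius.\<close>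
  have "deficit < \<epsilon> / real (cayley_radius G S K)"
    using large deg by (simp add: deficit_def alpha_pair_def field_simps)
  then have small: "real (cayley_radius G S K) * deficit < \<epsilon>"
    using rad by (simp add: field_simps)
  have "1 - \<epsilon> \<le> two_point P \<one> g" if "g \<in> K" for g
  proof -
    have "cayley_dist G S \<one> g \<le> cayley_radius G S K"
      unfolding cayley_radius_def using K that by (intro Max_ge) auto
    \<comment> \<open>Nonnegativity of \<open>deficit\<close> allows one uniform bound on
      \<open>K\<close>, with the radius in place of each distance.\<close>
    then have "real (cayley_dist G S \<one> g) * deficit \<le> real (cayley_radius G S K) * deficit"
      by (intro mult_right_mono deficit_nonneg) simp
    then show ?thesis
      using two_point_ge[of g] small K that by auto
  qed
  then show False
    using W normalized_pd_two_point vanish unfolding satisfies_W_def by auto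
qed

end

theorem proposition4p6:
  fixes G :: "('a, 'b) monoid_scheme" and S :: "'a set"
  assumes "group G" and "infinite (carrier G)" and "weakly_kazhdan G"
    and "finite S" and "S \<subseteq> carrier G" and "\<forall>s\<in>S. inv\<^bsub>G\<^esub> s \<in> S"
    and "generate G S = carrier G"
  shows "alpha_w_star G S \<le> kappa_w G S"
proof -
  interpret cayley_graph G S
    using assms by (intro cayley_graph.intro cayley_graph_axioms.intro) auto
  note deg = cayley_deg_pos[OF assms(2)]
  \<comment> \<open>Each \<open>alpha_pair\<close> is itself admissible in the infimum defining
    \<open>alpha_w_star\<close>; taking the infimum over all pairs then gives the claim.\<close>
  have "alpha_w_star G S \<le> ereal (alpha_pair G S \<epsilon> K)" if W: "satisfies_W G \<epsilon> K" for \<epsilon> K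
  proof -
    have K: "finite K" "K \<subseteq> carrier G" "0 < \<epsilon>"
      using W by (auto simp: satisfies_W_def)
    obtain g where g: "g \<in> K" "g \<noteq> \<one>\<^bsub>G\<^esub>"
      using satisfies_W_nondegenerate[OF W] by blast
    have "0 < cayley_dist G S \<one>\<^bsub>G\<^esub> g"
      using g K by (intro cayley_dist_pos) auto
    also have "\<dots> \<le> cayley_radius G S K"
      unfolding cayley_radius_def using K g by (intro Max_ge) auto
    finally have rad: "0 < cayley_radius G S K" .
    \<comment> \<open>Admissibility includes lying in [0,1). The lower bound comes from
      \<open>\<epsilon> < 1 \<le> ?D\<close>, the strict upper bound from positivity of \<epsilon>
      and \<open>?D\<close>.\<close>
    let ?D = "cayley_deg G S * cayley_radius G S K"
    have D: "1 \<le> ?D"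
      using deg rad by (simp add: Suc_le_eq)
    then have "\<epsilon> \<le> real ?D"
      using satisfies_W_nondegenerate(1)[OF W] by linarith
    then have "0 \<le> alpha_pair G S \<epsilon> K" "alpha_pair G S \<epsilon> K < 1"
      using K D by (auto simp: alpha_pair_def field_simps)
    moreover have "\<not> two_point_vanishes G S P"
      if "invariant_percolation G S P"
        "(\<integral>\<omega>. real (degree_in \<omega> \<one>\<^bsub>G\<^esub>) \<partial>P) > alpha_pair G S \<epsilon> K * real (cayley_deg G S)" for P
    proof -
      interpret cayley_percolation G S P
        by unfold_locales (rule that(1))
      show ?thesis
        by (rule not_two_point_vanishes[OF W deg rad that(2)])
    qed
    ultimately show ?thesis
      unfolding alpha_w_star_def by (intro Inf_lower imageI) auto
  qed
  then show ?thesis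
    unfolding kappa_w_def by (auto intro!: Inf_greatest)
qed

end
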